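(* Let $(E,\mathcal{E},m)$ be a probability space, $S:E\to E$ a bimeasurable bijection preserving $m$, and $c:E\to(0,+\infty)$ a measurable function. For $n\in\mathbb{Z}$ set $c_n:=c\circ S^n$. Define functions on $E$ by $r(0):=c=:r'(0)$ and, for $n\ge 1$, $$r(n):=c_{-n}/r(n-1),\qquad r'(n):=c_n/r'(n-1),$$ and, for $n\ge 0$, let $$x[n]:=[r(0),r(1),\ldots,r(n)],\qquad x'[n]:=[r'(0),r'(1),\ldots,r'(n)]$$ be the corresponding finite continued fractions. Then, for every $n\ge 1$, $$x'[n-1]\cdot\bigl(x[n]\circ S^{n+1}\bigr)=x'[n]\cdot\bigl(x[n-1]\circ S^{n+1}\bigr)$$ as functions on $E$.
   Context: For positive real numbers $s_0,\ldots,s_n$, the finite continued fraction $[s_0,s_1,\ldots,s_n]$ is defined recursively by $[s_n]:=s_n$ and $[s_0,s_1,\ldots,s_n]:=s_0+1/[s_1,s_2,\ldots,s_n]$; for functions it is defined pointwise. *)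

theory Defs
  imports "HOL-Probability.Probability"
begin

fun contfrac :: "real list \<Rightarrow> real" where
  "contfrac [s] = s"
| "contfrac (s # t # ts) = s + 1 / contfrac (t # ts)"

(* S is meant to be a bijection of E; negative iterates use its inverse on E,
   since E (the space of a measure) need not be the whole type. *)
definition iterate_on :: "'a set \<Rightarrow> ('a \<Rightarrow> 'a) \<Rightarrow> int \<Rightarrow> 'a \<Rightarrow> 'a" where
  "iterate_on E S k = (if k \<ge> 0 then S ^^ nat k else the_inv_into E S ^^ nat (- k))"

definition shifted :: "'a set \<Rightarrow> ('a \<Rightarrow> 'a) \<Rightarrow> ('a \<Rightarrow> real) \<Rightarrow> int \<Rightarrow> 'a \<Rightarrow> real" where
  "shifted E S c k = c \<circ> iterate_on E S k"

primrec r_back :: "'a set \<Rightarrow> ('a \<Rightarrow> 'a) \<Rightarrow> ('a \<Rightarrow> real) \<Rightarrow> nat \<Rightarrow> 'a \<Rightarrow> real" where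
  "r_back E S c 0 = c"
| "r_back E S c (Suc n) = (\<lambda>y. shifted E S c (- int (Suc n)) y / r_back E S c n y)"

primrec r_forw :: "'a set \<Rightarrow> ('a \<Rightarrow> 'a) \<Rightarrow> ('a \<Rightarrow> real) \<Rightarrow> nat \<Rightarrow> 'a \<Rightarrow> real" where
  "r_forw E S c 0 = c"
| "r_forw E S c (Suc n) = (\<lambda>y. shifted E S c (int (Suc n)) y / r_forw E S c n y)"

definition x_back :: "'a set \<Rightarrow> ('a \<Rightarrow> 'a) \<Rightarrow> ('a \<Rightarrow> real) \<Rightarrow> nat \<Rightarrow> 'a \<Rightarrow> real" where
  "x_back E S c n = (\<lambda>y. contfrac (map (\<lambda>k. r_back E S c k y) [0..<Suc n]))"

definition x_forw :: "'a set \<Rightarrow> ('a \<Rightarrow> 'a) \<Rightarrow> ('a \<Rightarrow> real) \<Rightarrow> nat \<Rightarrow> 'a \<Rightarrow> real" where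
  "x_forw E S c n = (\<lambda>y. contfrac (map (\<lambda>k. r_forw E S c k y) [0..<Suc n]))"

end

theory Submission
  imports Defs
begin

text \<open>
  Fix \<open>y\<close> and write \<open>a\<^sub>k = c (S\<^sup>k y)\<close>. By construction two neighbouring partial quotients of
  \<open>x'[n] y\<close> multiply to \<open>a\<^sub>1, ..., a\<^sub>n\<close> in turn, and those of \<open>x[n] (S\<^bsup>n+1\<^esup> y)\<close> multiply to
  \<open>a\<^sub>n, ..., a\<^sub>1\<close>: the same numbers in the opposite order. Apart from the factor \<open>s\<^sub>0\<close>, a continued
  fraction \<open>[s\<^sub>0, ..., s\<^sub>n]\<close> depends only on these products, because an equivalence transformation
  turns it into \<open>s\<^sub>0 (1 + b\<^sub>1 / (1 + b\<^sub>2 / (1 + ...)))\<close> with \<open>b\<^sub>k = 1 / (s\<^bsub>k-1\<^esub> s\<^sub>k)\<close>. Such a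
  fraction is a quotient \<open>D(b\<^sub>1, ..., b\<^sub>n) / D(b\<^sub>2, ..., b\<^sub>n)\<close> of continuants
  (\<open>contfrac_eq_continuant_quotient\<close>).

  Continuants are invariant under reversal of their arguments (\<open>continuant_rev\<close>). With
  \<open>b\<^sub>k = 1 / a\<^sub>k\<close> and \<open>D\<^bsub>i,j\<^esub> = D(b\<^sub>i, ..., b\<^sub>j)\<close> (which is 1 for \<open>i > j\<close>) this gives
    \<open>x'[n] = a\<^sub>0 D\<^bsub>1,n\<^esub> / D\<^bsub>2,n\<^esub>\<close>,  \<open>x'[n-1] = a\<^sub>0 D\<^bsub>1,n-1\<^esub> / D\<^bsub>2,n-1\<^esub>\<close>,
  and at the point \<open>S\<^bsup>n+1\<^esup> y\<close>
    \<open>x[n] = a\<^bsub>n+1\<^esub> D\<^bsub>1,n\<^esub> / D\<^bsub>1,n-1\<^esub>\<close>,  \<open>x[n-1] = a\<^bsub>n+1\<^esub> D\<^bsub>2,n\<^esub> / D\<^bsub>2,n-1\<^esub>\<close>.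
  Both sides of the claim are therefore \<open>a\<^sub>0 a\<^bsub>n+1\<^esub> D\<^bsub>1,n\<^esub> / D\<^bsub>2,n-1\<^esub>\<close>
  (\<open>contfrac_mult_reversed\<close>).
\<close>

text \<open>
  The numerator of the continued fraction \<open>1 + b\<^sub>1 / (1 + b\<^sub>2 / (1 + ...))\<close>, cleared of fractions;
  its denominator is the same polynomial in \<open>b\<^sub>2, ..., b\<^sub>n\<close>. Euler's continuant of partial quotients
  becomes this one under the equivalence transformation.
\<close>

fun continuant :: "real list \<Rightarrow> real" where
  "continuant [] = 1"
| "continuant [b] = 1 + b"
| "continuant (b # b' # bs) = continuant (b' # bs) + b * continuant bs"

lemma continuant_Cons: "continuant (b # bs) = continuant bs + b * continuant (tl bs)"
  by (cases bs) auto

lemma continuant_pos: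
  assumes "\<forall>b\<in>set bs. b > 0"
  shows "continuant bs > 0"
  using assms by (induction bs rule: continuant.induct) (auto intro!: add_pos_pos mult_pos_pos)

lemma continuant_snoc2:
  "continuant (bs @ [b', b]) = continuant (bs @ [b']) + b * continuant bs"
  by (induction bs rule: continuant.induct) (simp_all add: algebra_simps)

text \<open>
  The recursion peels off arguments at the left end, \<open>continuant_snoc2\<close> is the same recursion at
  the right end; reversal exchanges the two.
\<close>

lemma continuant_rev: "continuant (rev bs) = continuant bs"
  by (induction bs rule: continuant.induct) (simp_all add: continuant_snoc2)

text \<open>
  The equivalence transformation: each tail \<open>[s\<^sub>i, ...]\<close> is \<open>s\<^sub>i\<close> times a fraction, and the factor
  \<open>s\<^bsub>i+1\<^esub>\<close> of the next tail is absorbed into the partial numerator \<open>1 / (s\<^sub>i s\<^bsub>i+1\<^esub>)\<close>.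
\<close>

lemma contfrac_eq_continuant_quotient:
  fixes s :: "nat \<Rightarrow> real"
  assumes pos: "\<And>k. s k > 0"
  shows "contfrac (map s [i..<Suc (i + n)]) =
    s i * continuant (map (\<lambda>k. 1 / (s k * s (Suc k))) [i..<i + n])
        / continuant (map (\<lambda>k. 1 / (s k * s (Suc k))) [Suc i..<i + n])"
proof (induction n arbitrary: i)
  case 0
  then show ?case by simp
next
  case (Suc n)
  let ?b = "\<lambda>k. 1 / (s k * s (Suc k))"
  let ?D1 = "continuant (map ?b [Suc i..<Suc i + n])"
  let ?D2 = "continuant (map ?b [Suc (Suc i)..<Suc i + n])"
  have "?D1 > 0" "?D2 > 0"
    using pos by (auto intro!: continuant_pos)
  have "tl (map ?b [Suc i..<Suc i + n]) = map ?b [Suc (Suc i)..<Suc i + n]"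
    by (simp flip: map_tl)
  then have D: "continuant (map ?b [i..<i + Suc n]) = ?D1 + ?b i * ?D2"
    by (simp add: upt_conv_Cons continuant_Cons del: upt_Suc)
  have "contfrac (map s [i..<Suc (i + Suc n)]) = s i + 1 / contfrac (map s [Suc i..<Suc (Suc i + n)])"
    by (simp add: upt_conv_Cons del: upt_Suc)
  also have "\<dots> = s i + ?D2 / (s (Suc i) * ?D1)"
    by (simp only: Suc.IH divide_divide_eq_right mult_1_left)
  also have "\<dots> = s i * (?D1 + ?b i * ?D2) / ?D1"
    using pos[of i] pos[of "Suc i"] \<open>?D1 > 0\<close> by (simp add: field_simps del: upt_Suc)
  finally show ?case
    using D by simp
qed

lemma map_reindex_rev_upt:
  assumes "i \<le> j" "j \<le> n"
  shows "map (\<lambda>k. b (n - Suc k)) [i..<j] = rev (map b [n - j..<n - i])"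
  using assms by (auto intro!: nth_equalityI simp: rev_nth)

text \<open>
  The pointwise content of the theorem: all that matters about the two sequences of partial
  quotients is that the products of neighbours occur in opposite orders.
\<close>

lemma contfrac_mult_reversed:
  fixes p q :: "nat \<Rightarrow> real"
  assumes p: "\<And>k. p k > 0" and q: "\<And>k. q k > 0"
    and prods: "\<And>k. k \<le> n \<Longrightarrow> q k * q (Suc k) = p (n - k) * p (Suc (n - k))"
  shows "contfrac (map p [0..<Suc n]) * contfrac (map q [0..<Suc (Suc n)]) =
    contfrac (map p [0..<Suc (Suc n)]) * contfrac (map q [0..<Suc n])"
proof -
  let ?b = "\<lambda>k. 1 / (p k * p (Suc k))"
  let ?D = "\<lambda>i j. continuant (map ?b [i..<j])"
  have pos: "?D i j > 0" for i j
    using p by (auto intro!: continuant_pos)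
  have rev: "continuant (map (\<lambda>k. 1 / (q k * q (Suc k))) [i..<j]) = ?D (Suc n - j) (Suc n - i)"
    if "i \<le> j" "j \<le> Suc n" for i j
  proof -
    have "map (\<lambda>k. 1 / (q k * q (Suc k))) [i..<j] = map (\<lambda>k. ?b (Suc n - Suc k)) [i..<j]"
      using that prods by auto
    then show ?thesis
      using map_reindex_rev_upt[OF that, of ?b] by (simp only: continuant_rev)
  qed
  \<comment> \<open>For \<open>n = 0\<close> the interval \<open>[1..<n]\<close> has its ends the wrong way round, but both lists are empty.\<close>
  have rev': "continuant (map (\<lambda>k. 1 / (q k * q (Suc k))) [1..<n]) = ?D 1 n"
    using rev[of 1 n] by (cases n) (simp_all del: upt_Suc)
  have P0: "contfrac (map p [0..<Suc n]) = p 0 * ?D 0 n / ?D 1 n"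
    using contfrac_eq_continuant_quotient[of p 0 n, OF p] by (simp del: upt_Suc)
  have P1: "contfrac (map p [0..<Suc (Suc n)]) = p 0 * ?D 0 (Suc n) / ?D 1 (Suc n)"
    using contfrac_eq_continuant_quotient[of p 0 "Suc n", OF p] by (simp del: upt_Suc)
  have Q0: "contfrac (map q [0..<Suc n]) = q 0 * ?D 1 (Suc n) / ?D 1 n"
    using contfrac_eq_continuant_quotient[of q 0 n, OF q] rev[of 0 n] rev'
    by (simp del: upt_Suc)
  have Q1: "contfrac (map q [0..<Suc (Suc n)]) = q 0 * ?D 0 (Suc n) / ?D 0 n"
    using contfrac_eq_continuant_quotient[of q 0 "Suc n", OF q] rev[of 0 "Suc n"] rev[of 1 "Suc n"]
    by (simp del: upt_Suc)
  show ?thesis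
    unfolding P0 P1 Q0 Q1
    using pos[of 0 n] pos[of 1 n] pos[of 0 "Suc n"] pos[of 1 "Suc n"]
    by (simp add: field_simps del: upt_Suc)
qed

lemma funpow_in:
  assumes "\<And>x. x \<in> E \<Longrightarrow> f x \<in> E" "x \<in> E"
  shows "(f ^^ k) x \<in> E"
  using assms by (induction k) auto

lemma iterate_on_in:
  assumes "bij_betw S E E" "y \<in> E"
  shows "iterate_on E S k y \<in> E"
  using assms bij_betw_the_inv_into[OF assms(1)]
  by (auto simp: iterate_on_def intro!: funpow_in dest: bij_betwE)

lemma iterate_on_diff:
  assumes S: "bij_betw S E E" and y: "y \<in> E" and "j \<le> N"
  shows "iterate_on E S (- int j) (iterate_on E S (int N) y) = iterate_on E S (int (N - j)) y"
proof -
  have "(the_inv_into E S ^^ j) ((S ^^ N) y) = (S ^^ (N - j)) y"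
    using \<open>j \<le> N\<close>
  proof (induction j)
    case 0
    then show ?case by simp
  next
    case (Suc j)
    have "(S ^^ (N - Suc j)) y \<in> E"
      using S y by (auto intro!: funpow_in dest: bij_betwE)
    then have "the_inv_into E S (S ((S ^^ (N - Suc j)) y)) = (S ^^ (N - Suc j)) y"
      using S by (simp add: the_inv_into_f_f bij_betw_imp_inj_on)
    moreover have "N - j = Suc (N - Suc j)"
      using Suc.prems by simp
    ultimately show ?case
      using Suc by simp
  qed
  then show ?thesis
    by (cases "j = 0") (simp_all add: iterate_on_def)
qed

lemma r_pos:
  assumes "bij_betw S E E" "\<And>y. y \<in> E \<Longrightarrow> c y > 0" "y \<in> E"
  shows r_forw_pos: "r_forw E S c k y > 0" and r_back_pos: "r_back E S c k y > 0"
  using assms by (induction k) (auto simp: shifted_def intro!: divide_pos_pos iterate_on_in)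

theorem mainTheorem2:
  fixes M :: "'a measure" and S :: "'a \<Rightarrow> 'a" and c :: "'a \<Rightarrow> real" and n :: nat
  assumes "prob_space M"
    and "bij_betw S (space M) (space M)"
    and "S \<in> measurable M M"
    and "the_inv_into (space M) S \<in> measurable M M"
    and "distr M M S = M"
    and "c \<in> borel_measurable M"
    and "\<And>y. y \<in> space M \<Longrightarrow> c y > 0"
    and "n \<ge> 1"
  shows "\<forall>y\<in>space M.
    x_forw (space M) S c (n - 1) y * (x_back (space M) S c n \<circ> iterate_on (space M) S (int (n + 1))) y =
    x_forw (space M) S c n y * (x_back (space M) S c (n - 1) \<circ> iterate_on (space M) S (int (n + 1))) y"
proof
  fix y assume y: "y \<in> space M"
  let ?E = "space M"
  let ?z = "iterate_on ?E S (int (n + 1)) y"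
  let ?p = "\<lambda>k. r_forw ?E S c k y" and ?q = "\<lambda>k. r_back ?E S c k ?z"
  note S = assms(2) and c = assms(7)
  have z: "?z \<in> ?E"
    using iterate_on_in[OF S y] .
  have p: "?p k > 0" and q: "?q k > 0" for k
    using r_forw_pos[of S ?E c y k, OF S c y] r_back_pos[of S ?E c ?z k, OF S c z] by auto
  obtain m where n: "n = Suc m"
    using assms(8) by (cases n) auto
  have "?q k * ?q (Suc k) = ?p (m - k) * ?p (Suc (m - k))" if "k \<le> m" for k
  proof -
    have "?q k * ?q (Suc k) = c (iterate_on ?E S (- int (Suc k)) ?z)"
      using q[of k] by (simp add: shifted_def)
    also have "iterate_on ?E S (- int (Suc k)) ?z = iterate_on ?E S (int (n + 1 - Suc k)) y"
      using iterate_on_diff[OF S y, of "Suc k" "n + 1"] that n by simp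
    also have "n + 1 - Suc k = Suc (m - k)"
      using that n by simp
    also have "c (iterate_on ?E S (int (Suc (m - k))) y) = ?p (m - k) * ?p (Suc (m - k))"
      using p[of "m - k"] by (simp add: shifted_def)
    finally show ?thesis .
  qed
  from contfrac_mult_reversed[of ?p ?q m, OF p q this]
  show "x_forw ?E S c (n - 1) y * (x_back ?E S c n \<circ> iterate_on ?E S (int (n + 1))) y =
    x_forw ?E S c n y * (x_back ?E S c (n - 1) \<circ> iterate_on ?E S (int (n + 1))) y"
    by (simp add: x_forw_def x_back_def n del: upt_Suc)
qed

end
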